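(* Let $n,n'\ge2$ and $m,m'\ge1$ be integers. If there exists a boundary-regular biholomorphism $F:E_{n,m}\longrightarrow E_{n',m'}$, then $n=n'$ and $m=m'$.
   Context: $E_{n,m}=\{(z,w)\in\mathbb C^{n-1}\times\mathbb C: |z|^2+|w|^{2m}<1\}$. A biholomorphism $F:E_{n,m}\to E_{n',m'}$ is called boundary regular if there are open neighbourhoods $U\supset\overline{E_{n,m}}$ and $U'\supset\overline{E_{n',m'}}$ such that $F$ extends to a biholomorphism from $U$ onto $U'$. *)

theory Defs
  imports "HOL-Analysis.Analysis"
begin

text \<open>
  The space \<open>\<complex>\<^sup>n = \<complex>\<^sup>n\<^sup>-\<^sup>1 \<times> \<complex>\<close> is the type \<open>(complex ^ 'k) \<times> complex\<close> with \<open>CARD('k) = n - 1\<close>. Its library norm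
  is the Euclidean one, but the library only equips the product with a real scalar multiplication.
\<close>

definition cscale :: "complex \<Rightarrow> (complex ^ 'k) \<times> complex \<Rightarrow> (complex ^ 'k::finite) \<times> complex" where
  "cscale c p = (c *s fst p, c * snd p)"

lemma vector_space_cscale: "vector_space cscale"
  by unfold_locales
    (simp_all add: cscale_def vector_add_ldistrib vector_sadd_rdistrib vector_smult_assoc algebra_simps)

text \<open>
  A map of several complex variables is holomorphic on an open set if it is complex
  differentiable at each point, that is, its Frechet derivative exists and is complex linear.
\<close>

definition holomorphic_map_on ::
    "((complex ^ 'k::finite) \<times> complex \<Rightarrow> (complex ^ 'l::finite) \<times> complex) \<Rightarrow>
     ((complex ^ 'k) \<times> complex) set \<Rightarrow> bool" where
  "holomorphic_map_on F U \<longleftrightarrow>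
     (\<forall>p\<in>U. \<exists>D. (F has_derivative D) (at p) \<and> Vector_Spaces.linear cscale cscale D)"

definition biholomorphism ::
    "((complex ^ 'k::finite) \<times> complex \<Rightarrow> (complex ^ 'l::finite) \<times> complex) \<Rightarrow>
     ((complex ^ 'k) \<times> complex) set \<Rightarrow> ((complex ^ 'l) \<times> complex) set \<Rightarrow> bool" where
  "biholomorphism F U V \<longleftrightarrow>
     open U \<and> open V \<and> bij_betw F U V \<and>
     holomorphic_map_on F U \<and> holomorphic_map_on (inv_into U F) V"

definition egg :: "nat \<Rightarrow> ((complex ^ 'k::finite) \<times> complex) set" where
  "egg m = {(z, w). norm z ^ 2 + norm w ^ (2 * m) < 1}"

definition boundary_regular_biholomorphism ::
    "((complex ^ 'k::finite) \<times> complex \<Rightarrow> (complex ^ 'l::finite) \<times> complex) \<Rightarrow>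
     ((complex ^ 'k) \<times> complex) set \<Rightarrow> ((complex ^ 'l) \<times> complex) set \<Rightarrow> bool" where
  "boundary_regular_biholomorphism F E E' \<longleftrightarrow>
     biholomorphism F E E' \<and>
     (\<exists>U U' G. open U \<and> closure E \<subseteq> U \<and> open U' \<and> closure E' \<subseteq> U' \<and>
        biholomorphism G U U' \<and> (\<forall>p\<in>E. G p = F p))"

end

theory Submission
  imports Defs "HOL-Complex_Analysis.Conformal_Mappings"
begin

text \<open>
  The dimensions agree since the derivative of a biholomorphism is invertible. For \<open>m \<le> m'\<close>, fix a
  unit vector \<open>z\<^sub>0\<close>. The disc \<open>w \<mapsto> (z\<^sub>0, w)\<close> has distance \<open>O(|w|\<^sup>2\<^sup>m)\<close> to the boundary of the
  first egg, so its image \<open>(f, g)\<close> under the extended map satisfies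
  \<open>|f|\<^sup>2 + |g\<^sup>m\<^sup>'|\<^sup>2 \<le> 1 + O(|w|\<^sup>2\<^sup>m)\<close>, with equality to \<open>1\<close> at \<open>w = 0\<close>. For \<open>h = (f, g\<^sup>m\<^sup>')\<close> this gives
  \<open>|h - h(0)|\<^sup>2 \<le> O(|w|\<^sup>2\<^sup>m) - 2 Re H\<close> where \<open>H = \<langle>h - h(0), h(0)\<rangle>\<close> is holomorphic and vanishes at \<open>0\<close>.
  By the maximum principle every small circle has a point with \<open>Re H \<ge> 0\<close>, so \<open>h - h(0)\<close> has size
  \<open>O(|w|\<^sup>m)\<close> there. But \<open>(f, g)\<close> has nonzero derivative at \<open>0\<close>, which forces \<open>|h - h(0)| \<ge> c |w|\<^sup>i\<close>
  for some \<open>i \<le> m'\<close>. The inverse map gives \<open>m' \<le> m\<close>.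
\<close>

unbundle no fps_syntax

section \<open>Growth estimates for functions of one variable\<close>

text \<open>\<open>norm (exp (f t))\<close> is \<open>exp (Re (f t))\<close>, which equals 1 at the
  centre; by the maximum modulus principle it cannot stay below 1 on a whole circle.\<close>

lemma exists_on_sphere_Re_nonneg:
  assumes "f holomorphic_on ball 0 r" and "f 0 = 0" and "0 < \<rho>" and "\<rho> < r"
  shows "\<exists>t. norm t = \<rho> \<and> Re (f t) \<ge> 0"
proof (rule ccontr)
  assume "\<not> ?thesis"
  then have neg: "Re (f t) < 0" if "norm t = \<rho>" for t
    using that not_le by blast
  have hol: "f holomorphic_on cball 0 \<rho>"
    using assms by (auto intro: holomorphic_on_subset)
  have cont: "continuous_on (sphere 0 \<rho>) (\<lambda>t. norm (exp (f t)))"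
    using hol by (intro continuous_intros holomorphic_on_imp_continuous_on)
      (auto intro: holomorphic_on_subset)
  have "sphere (0::complex) \<rho> \<noteq> {}"
    using \<open>0 < \<rho>\<close> by simp
  then obtain s where s: "s \<in> sphere 0 \<rho>"
    and max: "\<And>t. t \<in> sphere 0 \<rho> \<Longrightarrow> norm (exp (f t)) \<le> norm (exp (f s))"
    using continuous_attains_sup[OF compact_sphere _ cont] by blast
  have "norm (exp (f 0)) \<le> norm (exp (f s))"
  proof (rule maximum_modulus_frontier[where f = "\<lambda>t. exp (f t)" and S = "cball 0 \<rho>"])
    show "(\<lambda>t. exp (f t)) holomorphic_on interior (cball 0 \<rho>)"
      using hol by (intro holomorphic_intros) (auto intro: holomorphic_on_subset)
    show "continuous_on (closure (cball 0 \<rho>)) (\<lambda>t. exp (f t))"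
      using hol by (intro continuous_intros) (simp add: holomorphic_on_imp_continuous_on)
  qed (use max \<open>0 < \<rho>\<close> in auto)
  then show False
    using neg[of s] s \<open>f 0 = 0\<close> by simp
qed

text \<open>Cauchy's estimate on discs of radius \<open>d / 2\<close> about points of
  \<open>ball a d\<close> bounds the derivative by \<open>2 * M / d\<close>; the mean value
  inequality on the convex ball does the rest.\<close>

lemma holomorphic_bounded_imp_Lipschitz:
  assumes hol: "f holomorphic_on ball a (2 * d)" and "d > 0"
    and bound: "\<And>x. x \<in> ball a (2 * d) \<Longrightarrow> norm (f x) \<le> M"
    and "x \<in> ball a d" and "y \<in> ball a d"
  shows "norm (f x - f y) \<le> (2 * M / d) * norm (x - y)"
proof (rule field_differentiable_bound[where S = "ball a d" and f' = "deriv f"])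
  fix z assume z: "z \<in> ball a d"
  have sub: "cball z (d / 2) \<subseteq> ball a (2 * d)"
  proof
    fix u assume "u \<in> cball z (d / 2)"
    then show "u \<in> ball a (2 * d)"
      using z \<open>d > 0\<close> dist_triangle[of a u z] by auto
  qed
  have "z \<in> ball a (2 * d)"
    using z \<open>d > 0\<close> by simp
  then show "(f has_field_derivative deriv f z) (at z within ball a d)"
    using hol by (meson DERIV_subset holomorphic_derivI open_ball subset_UNIV)
  have "norm ((deriv ^^ 1) f z) \<le> fact 1 * M / (d / 2) ^ 1"
  proof (rule Cauchy_inequality)
    show "f holomorphic_on ball z (d / 2)" "continuous_on (cball z (d / 2)) f"
      using hol sub by (meson ball_subset_cball holomorphic_on_subset
          holomorphic_on_imp_continuous_on order_trans)+
    show "norm (f u) \<le> M" if "norm (z - u) = d / 2" for u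
      using that sub bound by (auto simp: subset_iff dist_norm)
  qed (use \<open>d > 0\<close> in auto)
  then show "norm (deriv f z) \<le> 2 * M / d"
    by (simp add: mult.commute)
qed (use assms in auto)

lemma DERIV_nonzero_lower_bound:
  fixes f :: "complex \<Rightarrow> complex"
  assumes "(f has_field_derivative a) (at 0)" and "a \<noteq> 0"
  shows "\<exists>d>0. \<forall>t. norm t < d \<longrightarrow> norm a / 2 * norm t \<le> norm (f t - f 0)"
proof -
  have lim: "((\<lambda>t. (f t - f 0) / t) \<longlongrightarrow> a) (at 0)"
    using assms(1) by (simp add: has_field_derivative_iff)
  have "norm a / 2 > 0"
    using \<open>a \<noteq> 0\<close> by simp
  from LIM_D[OF lim this] obtain d where d: "d > 0"
    "\<And>t. t \<noteq> 0 \<Longrightarrow> norm t < d \<Longrightarrow> norm ((f t - f 0) / t - a) < norm a / 2"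
    by auto
  have "norm a / 2 * norm t \<le> norm (f t - f 0)" if "norm t < d" for t
  proof (cases "t = 0")
    case False
    have "norm a \<le> norm ((f t - f 0) / t) + norm ((f t - f 0) / t - a)"
      by (metis add.commute norm_minus_commute norm_triangle_sub)
    with d(2)[OF False that] have "norm a / 2 \<le> norm ((f t - f 0) / t)"
      by linarith
    then have "norm a / 2 \<le> norm (f t - f 0) / norm t"
      by (simp only: norm_divide)
    then show ?thesis
      using False by (simp only: pos_le_divide_eq zero_less_norm_iff not_False_eq_True)
  qed simp
  then show ?thesis
    using d(1) by blast
qed

lemma power_le_near_0_imp_exponent_le:
  fixes c C d :: real
  assumes "c > 0" and "d > 0"
    and le: "\<And>x. 0 < x \<Longrightarrow> x < d \<Longrightarrow> c * x ^ i \<le> C * x ^ j"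
  shows "j \<le> i"
proof (rule ccontr)
  assume "\<not> j \<le> i"
  then obtain l where l: "j = i + Suc l"
    by (metis less_iff_Suc_add not_le add_Suc_right)
  \<comment> \<open>Below \<open>d\<close> for the hypothesis, at most 1 so that
    \<open>x ^ Suc l\<close> is at most \<open>x\<close>, and small enough that
    \<open>(|C| + 1) * x\<close> is at most \<open>c / 2\<close>.\<close>
  define x where "x = Min {d / 2, 1, c / (2 * (\<bar>C\<bar> + 1))}"
  have x: "0 < x" "x < d" "x \<le> 1" "x \<le> c / (2 * (\<bar>C\<bar> + 1))"
    unfolding x_def using assms(1,2)
    by (auto intro: Min.coboundedI intro!: le_less_trans[OF Min.coboundedI, of _ "d / 2"])
  have "c * x ^ i \<le> (C * x ^ Suc l) * x ^ i"
    using le[OF x(1,2)] by (simp add: l power_add mult_ac)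
  then have "c \<le> C * x ^ Suc l"
    using x(1) by simp
  also have "\<dots> \<le> \<bar>C\<bar> * x ^ Suc l"
    using x(1) by (intro mult_right_mono) auto
  also have "\<dots> \<le> \<bar>C\<bar> * x"
    using x by (intro mult_left_mono) (auto simp: mult_left_le power_le_one)
  also have "\<dots> \<le> (\<bar>C\<bar> + 1) * x"
    using x(1) by simp
  also have "\<dots> \<le> c / 2"
    using x(4) by (simp add: field_simps)
  finally show False
    using \<open>c > 0\<close> by simp
qed

section \<open>Contact of a holomorphic disc with the boundary of an egg\<close>

text \<open>On each small circle of radius \<open>x\<close> some point has squared deviation of
  \<open>(f, g ^ k)\<close> from its value at 0 at most \<open>C * x ^ (2 * m)\<close>, while the
  nonzero velocity keeps it above a constant times \<open>x ^ (2 * i)\<close> for some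
  \<open>i \<le> k\<close>. Letting the radius shrink compares the exponents.\<close>

lemma disc_contact_order_le:
  fixes f :: "complex \<Rightarrow> complex ^ 'l::finite" and g :: "complex \<Rightarrow> complex"
  assumes "r > 0" and "k \<ge> 1"
    and f: "\<And>j. (\<lambda>t. f t $ j) holomorphic_on ball 0 r" and g: "g holomorphic_on ball 0 r"
    and f': "\<And>j. ((\<lambda>t. f t $ j) has_field_derivative a $ j) (at 0)"
    and g': "(g has_field_derivative b) (at 0)" and nz: "(a, b) \<noteq> 0"
    and eq0: "norm (f 0) ^ 2 + norm (g 0) ^ (2 * k) = 1"
    and le: "\<And>t. norm t < r \<Longrightarrow> norm (f t) ^ 2 + norm (g t) ^ (2 * k) \<le> 1 + C * norm t ^ (2 * m)"
  shows "m \<le> k"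
proof -
  define \<Delta> where "\<Delta> t = norm (f t - f 0) ^ 2 + norm (g t ^ k - g 0 ^ k) ^ 2" for t
  \<comment> \<open>The conjugated factors are constants, so \<open>H\<close> is holomorphic; its
    real part is the inner product in the linear term when the squared norm of
    \<open>(f, g ^ k)\<close> is expanded about its value at 0.\<close>
  define H where "H t = (\<Sum>j\<in>UNIV. cnj (f 0 $ j) * (f t $ j - f 0 $ j))
     + cnj (g 0 ^ k) * (g t ^ k - g 0 ^ k)" for t
  have H: "H holomorphic_on ball 0 r" "H 0 = 0"
    unfolding H_def by (intro holomorphic_intros f g) simp
  have Re_H: "Re (H t) = f 0 \<bullet> (f t - f 0) + g 0 ^ k \<bullet> (g t ^ k - g 0 ^ k)" for t
    by (simp add: H_def inner_vec_def inner_complex_def del: complex_cnj_power)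
  have expand: "norm (f t) ^ 2 + norm (g t) ^ (2 * k) = 1 + 2 * Re (H t) + \<Delta> t" for t
  proof -
    have sq: "norm y ^ 2 = norm x ^ 2 + 2 * (x \<bullet> (y - x)) + norm (y - x) ^ 2"
      for x y :: "'z::real_inner"
      by (simp add: power2_norm_eq_inner algebra_simps inner_commute)
    have "norm (g s) ^ (2 * k) = norm (g s ^ k) ^ 2" for s
      by (simp add: norm_power mult.commute flip: power_mult)
    then show ?thesis
      using sq[of "f t" "f 0"] sq[of "g t ^ k" "g 0 ^ k"] eq0 by (simp add: Re_H \<Delta>_def)
  qed
  have small: "\<exists>t. norm t = \<rho> \<and> \<Delta> t \<le> C * \<rho> ^ (2 * m)" if \<rho>: "0 < \<rho>" "\<rho> < r" for \<rho>
  proof -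
    obtain t where "norm t = \<rho>" "Re (H t) \<ge> 0"
      using exists_on_sphere_Re_nonneg[OF H \<rho>] by blast
    then show ?thesis
      using expand[of t] le[of t] \<rho> by force
  qed
  \<comment> \<open>If some component of \<open>f\<close> has nonzero derivative, \<open>i\<close>
    is 1. Otherwise \<open>b\<close> is nonzero: if \<open>g 0 = 0\<close> then \<open>g ^ k\<close>
    vanishes to order \<open>k\<close> and \<open>i\<close> is \<open>k\<close>; if not,
    \<open>g ^ k\<close> has nonzero derivative and \<open>i\<close> is 1.\<close>
  obtain c d i where i: "c > 0" "d > 0" "i \<le> k"
    and lower: "\<And>t. norm t < d \<Longrightarrow> (c * norm t ^ i)\<^sup>2 \<le> \<Delta> t"
  proof (cases "a = 0")
    case False
    then obtain j where j: "a $ j \<noteq> 0"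
      by (auto simp: vec_eq_iff)
    obtain d where d: "d > 0"
      "\<And>t. norm t < d \<Longrightarrow> norm (a $ j) / 2 * norm t \<le> norm (f t $ j - f 0 $ j)"
      using DERIV_nonzero_lower_bound[OF f' j] by blast
    have "(norm (a $ j) / 2 * norm t ^ 1)\<^sup>2 \<le> \<Delta> t" if "norm t < d" for t
    proof -
      have "norm (a $ j) / 2 * norm t \<le> norm (f t - f 0)"
        using d(2)[OF that] Finite_Cartesian_Product.norm_nth_le[of "f t - f 0" j] by simp
      then have "(norm (a $ j) / 2 * norm t)\<^sup>2 \<le> norm (f t - f 0) ^ 2"
        by (intro power_mono) auto
      then show ?thesis
        by (simp add: \<Delta>_def add_increasing2)
    qed
    with d(1) j \<open>k \<ge> 1\<close> show ?thesis
      by (intro that[of "norm (a $ j) / 2" d 1]) auto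
  next
    case True
    with nz have b: "b \<noteq> 0"
      by (simp add: zero_prod_def)
    have \<Delta>: "norm (g t ^ k - g 0 ^ k) ^ 2 \<le> \<Delta> t" for t
      by (simp add: \<Delta>_def)
    show ?thesis
    proof (cases "g 0 = 0")
      case True
      obtain d where d: "d > 0"
        "\<And>t. norm t < d \<Longrightarrow> norm b / 2 * norm t \<le> norm (g t - g 0)"
        using DERIV_nonzero_lower_bound[OF g' b] by blast
      have "((norm b / 2) ^ k * norm t ^ k)\<^sup>2 \<le> \<Delta> t" if "norm t < d" for t
      proof -
        have "(norm b / 2 * norm t) ^ k \<le> norm (g t ^ k - g 0 ^ k)"
          using d(2)[OF that] True \<open>k \<ge> 1\<close> by (auto simp: norm_power power_0_left intro: power_mono)
        then have "((norm b / 2 * norm t) ^ k)\<^sup>2 \<le> norm (g t ^ k - g 0 ^ k) ^ 2"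
          by (intro power_mono) auto
        with \<Delta>[of t] show ?thesis
          by (simp only: power_mult_distrib)
      qed
      with d(1) b show ?thesis
        by (intro that[of "(norm b / 2) ^ k" d k]) auto
    next
      case False
      define e where "e = of_nat k * (b * g 0 ^ (k - 1))"
      have "e \<noteq> 0"
        using False b \<open>k \<ge> 1\<close> by (simp add: e_def)
      have "((\<lambda>t. g t ^ k) has_field_derivative e) (at 0)"
        using DERIV_power[OF g', of k] by (simp add: e_def)
      from DERIV_nonzero_lower_bound[OF this \<open>e \<noteq> 0\<close>] obtain d where d: "d > 0"
        "\<And>t. norm t < d \<Longrightarrow> norm e / 2 * norm t \<le> norm (g t ^ k - g 0 ^ k)"
        by blast
      have "(norm e / 2 * norm t ^ 1)\<^sup>2 \<le> \<Delta> t" if "norm t < d" for t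
      proof -
        have "(norm e / 2 * norm t)\<^sup>2 \<le> norm (g t ^ k - g 0 ^ k) ^ 2"
          using d(2)[OF that] by (intro power_mono) auto
        with \<Delta>[of t] show ?thesis
          by (simp only: power_one_right)
      qed
      with d(1) \<open>e \<noteq> 0\<close> \<open>k \<ge> 1\<close> show ?thesis
        by (intro that[of "norm e / 2" d 1]) auto
    qed
  qed
  have "2 * m \<le> 2 * i"
  proof (rule power_le_near_0_imp_exponent_le)
    show "c\<^sup>2 > 0" "min d r > 0"
      using i \<open>r > 0\<close> by auto
    show "c\<^sup>2 * x ^ (2 * i) \<le> C * x ^ (2 * m)" if x: "0 < x" "x < min d r" for x
    proof -
      obtain t where t: "norm t = x" "\<Delta> t \<le> C * x ^ (2 * m)"
        using small[of x] x by auto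
      have "(c * x ^ i)\<^sup>2 \<le> \<Delta> t"
        using lower[of t] t x by simp
      with t show ?thesis
        by (simp add: power_mult_distrib mult.commute flip: power_mult)
    qed
  qed
  with \<open>i \<le> k\<close> show ?thesis
    by simp
qed

section \<open>Holomorphic maps on complex lines and their derivatives\<close>

text \<open>By the chain rule the slice has real derivative \<open>D (cscale h v)\<close> in
  direction \<open>h\<close>; complex linearity of \<open>D\<close> turns this into
  \<open>cscale h (D v)\<close>, hence into a complex derivative of each component.\<close>

lemma holomorphic_map_on_slice:
  fixes G :: "(complex ^ 'k::finite) \<times> complex \<Rightarrow> (complex ^ 'l::finite) \<times> complex"
  assumes D: "(G has_derivative D) (at (p + cscale t v))"
    and lin: "Vector_Spaces.linear cscale cscale D"
  shows "((\<lambda>s. fst (G (p + cscale s v)) $ j) has_field_derivative fst (D v) $ j) (at t)"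
    and "((\<lambda>s. snd (G (p + cscale s v))) has_field_derivative snd (D v)) (at t)"
proof -
  have "linear (\<lambda>h. cscale h v)"
    by (rule linearI) (simp_all add: cscale_def prod_eq_iff vec_eq_iff algebra_simps)
  then have "((\<lambda>s. p + cscale s v) has_derivative (\<lambda>h. cscale h v)) (at t)"
    by (auto intro!: derivative_eq_intros simp: linear_conv_bounded_linear
        bounded_linear_imp_has_derivative)
  from has_derivative_compose[OF this D]
  have *: "((\<lambda>s. G (p + cscale s v)) has_derivative (\<lambda>h. cscale h (D v))) (at t)"
    using lin unfolding Vector_Spaces.linear_iff by simp
  have "((\<lambda>s. fst (G (p + cscale s v)) $ j) has_derivative (\<lambda>h. fst (cscale h (D v)) $ j)) (at t)"
    by (intro bounded_linear.has_derivative[OF bounded_linear_vec_nth] has_derivative_fst *)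
  then show "((\<lambda>s. fst (G (p + cscale s v)) $ j) has_field_derivative fst (D v) $ j) (at t)"
    by (simp add: has_field_derivative_def cscale_def mult_commute_abs)
  have "((\<lambda>s. snd (G (p + cscale s v))) has_derivative (\<lambda>h. snd (cscale h (D v)))) (at t)"
    by (intro has_derivative_snd *)
  then show "((\<lambda>s. snd (G (p + cscale s v))) has_field_derivative snd (D v)) (at t)"
    by (simp add: has_field_derivative_def cscale_def mult_commute_abs)
qed

lemma holomorphic_map_on_slice_holomorphic:
  fixes G :: "(complex ^ 'k::finite) \<times> complex \<Rightarrow> (complex ^ 'l::finite) \<times> complex"
  assumes "holomorphic_map_on G U" and "open S" and "\<And>t. t \<in> S \<Longrightarrow> p + cscale t v \<in> U"
  shows "(\<lambda>t. fst (G (p + cscale t v)) $ j) holomorphic_on S"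
    and "(\<lambda>t. snd (G (p + cscale t v))) holomorphic_on S"
proof -
  have "\<exists>D. (G has_derivative D) (at (p + cscale t v)) \<and> Vector_Spaces.linear cscale cscale D"
    if "t \<in> S" for t
    using assms(1,3) that by (simp add: holomorphic_map_on_def)
  then show "(\<lambda>t. fst (G (p + cscale t v)) $ j) holomorphic_on S"
      "(\<lambda>t. snd (G (p + cscale t v))) holomorphic_on S"
    unfolding holomorphic_on_open[OF \<open>open S\<close>] by (blast intro: holomorphic_map_on_slice)+
qed

text \<open>By the chain rule the derivative of \<open>K\<close> is a left inverse of
  \<open>D\<close>. Source and target may have different dimensions.\<close>

lemma derivative_inj_of_left_inverse:
  assumes G: "(G has_derivative D) (at p)" and K: "K differentiable at (G p)"
    and "open U" "p \<in> U" and KG: "\<And>x. x \<in> U \<Longrightarrow> K (G x) = x"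
  shows "inj D"
proof -
  obtain D' where "(K has_derivative D') (at (G p))"
    using K by (auto simp: differentiable_def)
  from has_derivative_compose[OF G this]
  have "((\<lambda>x. x) has_derivative (\<lambda>x. D' (D x))) (at p)"
    by (rule has_derivative_transform_within_open[OF _ \<open>open U\<close> \<open>p \<in> U\<close>]) (rule KG)
  then have "(\<lambda>x. D' (D x)) = (\<lambda>x. x)"
    using has_derivative_ident has_derivative_unique by blast
  then show "inj D"
    by (metis injI)
qed

section \<open>Boundary points of eggs\<close>

lemma closure_egg_subset: "closure (egg m) \<subseteq> {p. norm (fst p) ^ 2 + norm (snd p) ^ (2 * m) \<le> 1}"
  by (rule closure_minimal) (auto simp: egg_def intro!: closed_Collect_le continuous_intros)

text \<open>Scaling \<open>z\<close> by factors in \<open>[0, 1)\<close> that tend to 1 gives points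
  of the egg converging to \<open>(z, w)\<close>; \<open>z \<noteq> 0\<close> makes the norm drop
  strictly.\<close>

lemma boundary_in_closure_egg:
  fixes z :: "complex ^ 'k::finite"
  assumes "norm z ^ 2 + norm w ^ (2 * m) = 1" and "z \<noteq> 0"
  shows "(z, w) \<in> closure (egg m)"
proof -
  define x where "x i = 1 - 1 / real (Suc i)" for i
  have x: "0 \<le> x i" "x i < 1" for i
    by (auto simp: x_def)
  have "x \<longlonglongrightarrow> 1 - 0"
    unfolding x_def using LIMSEQ_inverse_real_of_nat
    by (intro tendsto_intros) (simp add: inverse_eq_divide)
  then have "(\<lambda>i. (x i *\<^sub>R z, w)) \<longlonglongrightarrow> ((1 - 0) *\<^sub>R z, w)"
    by (intro tendsto_intros)
  moreover have "(x i *\<^sub>R z, w) \<in> egg m" for i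
  proof -
    have "norm (x i *\<^sub>R z) < norm z"
      using x[of i] \<open>z \<noteq> 0\<close> by simp
    then have "norm (x i *\<^sub>R z) ^ 2 < norm z ^ 2"
      by (intro power_strict_mono) auto
    then show ?thesis
      using assms(1) by (simp add: egg_def)
  qed
  ultimately show ?thesis
    unfolding closure_sequential by (intro exI[of _ "\<lambda>i. (x i *\<^sub>R z, w)"]) simp
qed

lemma norm_square_le_add:
  fixes x y :: "'a::real_normed_vector"
  assumes "norm x \<le> B" and "norm y \<le> B"
  shows "norm x ^ 2 \<le> norm y ^ 2 + 2 * B * norm (x - y)"
proof -
  have "norm x ^ 2 - norm y ^ 2 = (norm x + norm y) * (norm x - norm y)"
    by (simp add: power2_eq_square algebra_simps)
  also have "\<dots> \<le> (norm x + norm y) * norm (x - y)"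
    by (intro mult_left_mono norm_triangle_ineq2) auto
  also have "\<dots> \<le> 2 * B * norm (x - y)"
    using assms by (intro mult_right_mono) auto
  finally show ?thesis
    by simp
qed

lemma norm_vector_smult: "norm (c *s z) = norm c * norm z"
  for c :: complex and z :: "complex ^ 'k::finite"
  by (simp add: norm_vec_def norm_mult L2_set_right_distrib)

section \<open>Comparison of the exponents\<close>

text \<open>The flat disc of points \<open>(z0, w)\<close> leaves the first egg only to order
  \<open>2 * m\<close> in \<open>w\<close>, and its image leaves the second egg to no worse order,
  so \<open>disc_contact_order_le\<close> applies. The hypotheses are one-sided, so the roles of
  \<open>G\<close> and \<open>K\<close> can be exchanged.\<close>

lemma egg_exponent_le:
  fixes G :: "(complex ^ 'k::finite) \<times> complex \<Rightarrow> (complex ^ 'l::finite) \<times> complex"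
  assumes "m \<ge> 1" and "m' \<ge> 1" and "open U"
    and sub: "closure (egg m) \<subseteq> U"
    and G: "holomorphic_map_on G U"
    and K: "\<And>p. p \<in> U \<Longrightarrow> K differentiable at (G p)"
    and KG: "\<And>x. x \<in> U \<Longrightarrow> K (G x) = x"
    and image: "G ` egg m = egg m'"
  shows "m \<le> m'"
proof -
  have contG: "continuous_on U G"
    using G unfolding holomorphic_map_on_def
    by (meson continuous_at_imp_continuous_on has_derivative_continuous)
  \<comment> \<open>Continuity carries the closure into the closure; injectivity on \<open>U\<close>
    keeps a boundary point from landing in \<open>egg m'\<close>, all of whose points are already
    images of points of \<open>egg m\<close>.\<close>
  have boundary: "norm (fst (G p)) ^ 2 + norm (snd (G p)) ^ (2 * m') = 1"
    if "p \<in> closure (egg m)" "p \<notin> egg m" for p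
  proof -
    have "G p \<in> closure (egg m')"
      using image_closure_subset[of "egg m" G "closure (egg m')"] that contG sub image
        continuous_on_subset closure_subset by blast
    moreover have "G p \<notin> egg m'"
    proof
      assume "G p \<in> egg m'"
      then obtain q where "q \<in> egg m" "G q = G p"
        using image by (metis imageE)
      then show False
        using KG that sub closure_subset by (metis subsetD)
    qed
    ultimately show ?thesis
      using closure_egg_subset[of m'] by (fastforce simp: egg_def split: prod.splits)
  qed
  \<comment> \<open>Any unit vector would do; the coordinate picked by \<open>undefined\<close> is
    immaterial.\<close>
  define z0 :: "complex ^ 'k" where "z0 = axis undefined 1"
  have z0: "norm z0 = 1"
    by (simp add: z0_def norm_axis_1)
  then have "z0 \<noteq> 0"
    by auto
  have "(z0, 0) \<in> closure (egg m)"
    using z0 \<open>m \<ge> 1\<close> \<open>z0 \<noteq> 0\<close> by (intro boundary_in_closure_egg) auto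
  then have p0: "(z0, 0) \<in> U"
    using sub by blast
  obtain D where D: "(G has_derivative D) (at (z0, 0))" and lin: "Vector_Spaces.linear cscale cscale D"
    using G p0 by (auto simp: holomorphic_map_on_def)
  obtain e1 where e1: "e1 > 0" "ball (z0, 0) e1 \<subseteq> U"
    using \<open>open U\<close> p0 open_contains_ball by blast
  obtain e2 where e2: "e2 > 0" "\<And>p. dist p (z0, 0) < e2 \<Longrightarrow> dist (G p) (G (z0, 0)) < 1"
    using has_derivative_continuous[OF D] unfolding continuous_at_eps_delta
    by (metis zero_less_one)
  \<comment> \<open>The quarter leaves room for \<open>norm (t - 1) < 2 * r\<close> together with
    \<open>norm w < r\<close>; the 1 in the minimum keeps \<open>norm w\<close> below 1.\<close>
  define r where "r = min 1 (min e1 e2) / 4"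
  have r: "0 < r" "r \<le> 1 / 4" "4 * r \<le> e1" "4 * r \<le> e2"
    using e1 e2 by (auto simp: r_def)
  define B where "B = 1 + norm (G (z0, 0))"
  have "B \<ge> 1"
    by (simp add: B_def)
  have near: "dist (t *s z0, w) (z0, 0) < 4 * r" if "norm (t - 1) < 2 * r" "norm w < r" for t w
  proof -
    have "dist (t *s z0, w) (z0, 0) = norm ((t - 1) *s z0, w)"
      by (simp add: dist_norm vector_sub_rdistrib)
    also have "\<dots> \<le> norm ((t - 1) *s z0) + norm w"
      by (rule norm_Pair_le)
    also have "norm ((t - 1) *s z0) = norm (t - 1)"
      by (simp only: norm_vector_smult z0 mult_1_right)
    finally show ?thesis
      using that r by linarith
  qed
  have nearU: "(t *s z0, w) \<in> U" and bound: "norm (G (t *s z0, w)) \<le> B"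
    if "norm (t - 1) < 2 * r" "norm w < r" for t w
  proof -
    show "(t *s z0, w) \<in> U"
      using near[OF that] e1 r by (auto simp: dist_commute subset_iff)
    have "dist (G (t *s z0, w)) (G (z0, 0)) < 1"
      using near[OF that] r by (intro e2) auto
    then show "norm (G (t *s z0, w)) \<le> B"
      using norm_triangle_ineq2[of "G (t *s z0, w)" "G (z0, 0)"] by (simp add: B_def dist_norm)
  qed
  define A where "A t w = fst (G (t *s z0, w))" for t w
  define b where "b t w = snd (G (t *s z0, w)) ^ m'" for t w
  \<comment> \<open>Lipschitz constants in \<open>t\<close> from Cauchy's estimate with
    \<open>d = r\<close>: \<open>L\<close> for \<open>b\<close>, bounded by \<open>B ^ m'\<close>,
    and \<open>L1\<close> for each component of \<open>A\<close>, bounded by \<open>B\<close>. In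
    \<open>C\<close> each is multiplied by twice its bound to pass to squared norms;
    \<open>CARD('l)\<close> comes from summing components.\<close>
  define L where "L = 2 * B ^ m' / r"
  define L1 where "L1 = 2 * B / r"
  define C where "C = 2 * B * (of_nat CARD('l) * L1) + 2 * B ^ m' * L"
  have bounds: "norm (A t w) \<le> B" "norm (b t w) \<le> B ^ m'"
    if "norm (t - 1) < 2 * r" "norm w < r" for t w
  proof -
    have "norm (fst q) \<le> norm q" "norm (snd q) \<le> norm q" for q :: "(complex ^ 'l) \<times> complex"
      using norm_fst_le[of "fst q" "snd q"] norm_snd_le[of "snd q" "fst q"] by simp_all
    then have "norm (fst (G (t *s z0, w))) \<le> B" "norm (snd (G (t *s z0, w))) \<le> B"
      using bound[OF that] order_trans by blast+
    then show "norm (A t w) \<le> B" "norm (b t w) \<le> B ^ m'"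
      by (auto simp: A_def b_def norm_power intro: power_mono)
  qed
  have Lip: "norm (A 1 w - A t w) \<le> of_nat CARD('l) * L1 * norm (1 - t)"
      "norm (b 1 w - b t w) \<le> L * norm (1 - t)"
    if t: "norm (t - 1) < r" and w: "norm w < r" for t w
  proof -
    \<comment> \<open>The radial variable is made complex: the points \<open>(s *s z0, w)\<close>
      form a complex line, on which the one-variable estimate applies around
      \<open>s = 1\<close>.\<close>
    have slice: "(0, w) + cscale s (z0, 0) = (s *s z0, w)" for s
      by (simp add: cscale_def)
    have U: "(0, w) + cscale s (z0, 0) \<in> U" if "s \<in> ball 1 (2 * r)" for s
      using nearU[OF _ w, of s] that by (simp add: slice dist_norm norm_minus_commute)
    note hol = holomorphic_map_on_slice_holomorphic[OF G open_ball[of 1 "2 * r"] U, unfolded slice]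
    have t1: "1 \<in> ball 1 r" "t \<in> ball 1 r"
      using t r by (auto simp: dist_norm norm_minus_commute)
    have comp: "norm (A 1 w $ j - A t w $ j) \<le> L1 * norm (1 - t)" for j
      unfolding L1_def
    proof (rule holomorphic_bounded_imp_Lipschitz[OF _ r(1) _ t1])
      show "(\<lambda>s. A s w $ j) holomorphic_on ball 1 (2 * r)"
        unfolding A_def by (rule hol)
      show "norm (A s w $ j) \<le> B" if "s \<in> ball 1 (2 * r)" for s
        using bounds(1)[of s w] that w Finite_Cartesian_Product.norm_nth_le[of "A s w" j]
        by (simp add: dist_norm norm_minus_commute)
    qed
    have "norm (A 1 w - A t w) \<le> (\<Sum>j\<in>UNIV. norm ((A 1 w - A t w) $ j))"
      unfolding norm_vec_def by (rule L2_set_le_sum) simp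
    also have "\<dots> \<le> (\<Sum>j\<in>(UNIV :: 'l set). L1 * norm (1 - t))"
      using comp by (intro sum_mono) simp
    finally show "norm (A 1 w - A t w) \<le> of_nat CARD('l) * L1 * norm (1 - t)"
      by simp
    show "norm (b 1 w - b t w) \<le> L * norm (1 - t)"
      unfolding L_def
    proof (rule holomorphic_bounded_imp_Lipschitz[OF _ r(1) _ t1])
      show "(\<lambda>s. b s w) holomorphic_on ball 1 (2 * r)"
        unfolding b_def by (intro holomorphic_intros hol)
      show "norm (b s w) \<le> B ^ m'" if "s \<in> ball 1 (2 * r)" for s
        using bounds(2)[of s w] that w by (simp add: dist_norm norm_minus_commute)
    qed
  qed
  have b_sq: "norm (b t w) ^ 2 = norm (snd (G (t *s z0, w))) ^ (2 * m')" for t w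
    by (simp add: b_def norm_power mult.commute flip: power_mult)
  have contact: "norm (A 1 w) ^ 2 + norm (b 1 w) ^ 2 \<le> 1 + C * norm w ^ (2 * m)"
    if w: "norm w < r" for w
  proof -
    \<comment> \<open>This \<open>s\<close> makes \<open>(s *s z0, w)\<close> a boundary point,
      where the value is exactly 1. Its distance \<open>1 - s\<close> to \<open>(z0, w)\<close> is
      at most \<open>1 - s ^ 2\<close>, which is \<open>norm w ^ (2 * m)\<close>.\<close>
    define s where "s = sqrt (1 - norm w ^ (2 * m))"
    have "norm w ^ (2 * m) \<le> norm w ^ 1"
      using w r \<open>m \<ge> 1\<close> by (intro power_decreasing) auto
    then have wm: "norm w ^ (2 * m) < r" "norm w ^ (2 * m) < 1"
      using w r by auto
    then have s: "s > 0" "s \<le> 1" "s\<^sup>2 = 1 - norm w ^ (2 * m)"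
      by (auto simp: s_def)
    have "(1 - s) * 1 \<le> (1 - s) * (1 + s)"
      using s by (intro mult_left_mono) auto
    also have "\<dots> = norm w ^ (2 * m)"
      using s(3) by (simp add: algebra_simps power2_eq_square)
    finally have s1: "1 - s \<le> norm w ^ (2 * m)"
      by simp
    have ns: "norm (1 - complex_of_real s) = 1 - s"
      using s by (metis abs_of_nonneg diff_ge_0_iff_ge norm_of_real of_real_1 of_real_diff)
    have near_s: "norm (complex_of_real s - 1) < r"
      using ns s1 wm by (simp add: norm_minus_commute)
    have near_s2: "norm (complex_of_real s - 1) < 2 * r"
      using near_s r by linarith
    have ons: "norm (complex_of_real s *s z0) = s"
      using s by (simp add: norm_vector_smult z0)
    have eq: "norm (complex_of_real s *s z0) ^ 2 + norm w ^ (2 * m) = 1"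
      using s(3) by (simp add: ons)
    have "complex_of_real s *s z0 \<noteq> 0"
      using ons s(1) by auto
    with eq have "(complex_of_real s *s z0, w) \<in> closure (egg m)"
      by (rule boundary_in_closure_egg)
    moreover have "(complex_of_real s *s z0, w) \<notin> egg m"
      using eq by (simp add: egg_def)
    ultimately have one: "norm (A s w) ^ 2 + norm (b s w) ^ 2 = 1"
      unfolding b_sq by (simp add: A_def boundary)
    have r1: "norm ((1::complex) - 1) < 2 * r"
      using r by simp
    have "norm (A 1 w) ^ 2 \<le> norm (A s w) ^ 2 + 2 * B * norm (A 1 w - A s w)"
      by (intro norm_square_le_add bounds r1 near_s2 w)
    also have "\<dots> \<le> norm (A s w) ^ 2 + 2 * B * (of_nat CARD('l) * L1 * (1 - s))"
      using Lip(1)[OF near_s w] \<open>B \<ge> 1\<close> by (intro add_left_mono mult_left_mono) (auto simp: ns)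
    finally have 1: "norm (A 1 w) ^ 2 \<le> norm (A s w) ^ 2 + 2 * B * (of_nat CARD('l) * L1 * (1 - s))" .
    have "norm (b 1 w) ^ 2 \<le> norm (b s w) ^ 2 + 2 * B ^ m' * norm (b 1 w - b s w)"
      by (intro norm_square_le_add bounds r1 near_s2 w)
    also have "\<dots> \<le> norm (b s w) ^ 2 + 2 * B ^ m' * (L * (1 - s))"
      using Lip(2)[OF near_s w] \<open>B \<ge> 1\<close> by (intro add_left_mono mult_left_mono) (auto simp: ns)
    finally have 2: "norm (b 1 w) ^ 2 \<le> norm (b s w) ^ 2 + 2 * B ^ m' * (L * (1 - s))" .
    have "norm (A 1 w) ^ 2 + norm (b 1 w) ^ 2 \<le> 1 + C * (1 - s)"
      using 1 2 one by (simp add: C_def algebra_simps)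
    also have "\<dots> \<le> 1 + C * norm w ^ (2 * m)"
      using s1 \<open>B \<ge> 1\<close> r by (intro add_left_mono mult_left_mono) (auto simp: C_def L_def L1_def)
    finally show ?thesis .
  qed
  have disc: "(z0, 0) + cscale w (0, 1) = (z0, w)" for w
    by (simp add: cscale_def vector_smult_rzero)
  have discU: "(z0, 0) + cscale w (0, 1) \<in> U" if "w \<in> ball 0 r" for w
    using nearU[of 1 w] r that by (simp add: disc)
  have D0: "(G has_derivative D) (at ((z0, 0) + cscale 0 (0, 1)))"
    using D by (simp add: disc)
  \<comment> \<open>Injectivity makes the velocity \<open>D (0, 1)\<close> of the image disc
    nonzero.\<close>
  have "inj D"
    using derivative_inj_of_left_inverse[OF D K[OF p0] \<open>open U\<close> p0 KG] .
  moreover have "D 0 = 0"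
    using D by (simp add: has_derivative_bounded_linear linear_simps)
  ultimately have nz: "(fst (D (0, 1)), snd (D (0, 1))) \<noteq> 0"
    by (metis injD prod.collapse snd_zero snd_conv zero_neq_one)
  show ?thesis
  proof (rule disc_contact_order_le[where f = "\<lambda>w. fst (G (z0, w))" and g = "\<lambda>w. snd (G (z0, w))"
        and r = r and C = C, OF _ \<open>m' \<ge> 1\<close> _ _ _ _ nz])
    show "(\<lambda>w. fst (G (z0, w)) $ j) holomorphic_on ball 0 r" for j
      using holomorphic_map_on_slice_holomorphic(1)[OF G open_ball[of 0 r] discU] by (simp add: disc)
    show "(\<lambda>w. snd (G (z0, w))) holomorphic_on ball 0 r"
      using holomorphic_map_on_slice_holomorphic(2)[OF G open_ball[of 0 r] discU] by (simp add: disc)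
    show "((\<lambda>w. fst (G (z0, w)) $ j) has_field_derivative fst (D (0, 1)) $ j) (at 0)" for j
      using holomorphic_map_on_slice(1)[OF D0 lin] by (simp add: disc)
    show "((\<lambda>w. snd (G (z0, w))) has_field_derivative snd (D (0, 1))) (at 0)"
      using holomorphic_map_on_slice(2)[OF D0 lin] by (simp add: disc)
    show "norm (fst (G (z0, 0))) ^ 2 + norm (snd (G (z0, 0))) ^ (2 * m') = 1"
      using \<open>(z0, 0) \<in> closure (egg m)\<close> z0 by (intro boundary) (auto simp: egg_def)
    show "norm (fst (G (z0, t))) ^ 2 + norm (snd (G (z0, t))) ^ (2 * m') \<le> 1 + C * norm t ^ (2 * m)"
      if "norm t < r" for t
      using contact[OF that] unfolding b_sq by (simp add: A_def)
  qed (use r in auto)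
qed

section \<open>Equality of dimensions and conclusion\<close>

text \<open>The derivative at a single point is an injective real linear map, so the real dimensions
  \<open>2 * CARD('k) + 2\<close> and \<open>2 * CARD('l) + 2\<close> can be compared.\<close>

lemma card_le_of_left_inverse:
  fixes G :: "(complex ^ 'k::finite) \<times> complex \<Rightarrow> (complex ^ 'l::finite) \<times> complex"
  assumes "G differentiable at p" and "K differentiable at (G p)"
    and "open U" "p \<in> U" and "\<And>x. x \<in> U \<Longrightarrow> K (G x) = x"
  shows "CARD('k) \<le> CARD('l)"
proof -
  obtain D where D: "(G has_derivative D) (at p)"
    using assms(1) by (auto simp: differentiable_def)
  have "inj D"
    using derivative_inj_of_left_inverse[OF D assms(2-)] .
  moreover have "linear D"
    using D has_derivative_linear by blast
  ultimately have "dim (range D) = dim (UNIV :: ((complex ^ 'k) \<times> complex) set)"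
    by (intro dim_image_eq) auto
  moreover have "dim (range D) \<le> DIM((complex ^ 'l) \<times> complex)"
    by (rule dim_subset_UNIV)
  ultimately show ?thesis
    by simp
qed

theorem theorem5p4:
  fixes n n' m m' :: nat
  assumes "n \<ge> 2" and "n' \<ge> 2" and "m \<ge> 1" and "m' \<ge> 1"
    and "CARD('k::finite) = n - 1" and "CARD('l::finite) = n' - 1"
    and "\<exists>F. boundary_regular_biholomorphism F
           (egg m :: ((complex ^ 'k) \<times> complex) set)
           (egg m' :: ((complex ^ 'l) \<times> complex) set)"
  shows "n = n' \<and> m = m'"
proof -
  define E :: "((complex ^ 'k) \<times> complex) set" where "E = egg m"
  define E' :: "((complex ^ 'l) \<times> complex) set" where "E' = egg m'"
  obtain F U U' G where F: "bij_betw F E E'"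
    and U: "open U" "closure E \<subseteq> U" and U': "open U'" "closure E' \<subseteq> U'"
    and G: "bij_betw G U U'" "holomorphic_map_on G U" "holomorphic_map_on (inv_into U G) U'"
    and GF: "\<And>p. p \<in> E \<Longrightarrow> G p = F p"
    using assms(7) by (auto simp: boundary_regular_biholomorphism_def biholomorphism_def E_def E'_def)
  define K where "K = inv_into U G"
  have KG: "K (G x) = x" if "x \<in> U" for x
    using that G(1) by (simp add: K_def bij_betw_inv_into_left)
  have GK: "G (K y) = y" if "y \<in> U'" for y
    using that G(1) by (simp add: K_def bij_betw_inv_into_right)
  have GU: "G x \<in> U'" if "x \<in> U" for x
    using that G(1) bij_betwE by blast
  have KU: "K y \<in> U" if "y \<in> U'" for y
    using that G(1) bij_betwE bij_betw_inv_into unfolding K_def by blast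
  have holK: "holomorphic_map_on K U'"
    using G(3) by (simp add: K_def)
  have dG: "G differentiable at x" if "x \<in> U" for x
    using that G(2) by (auto simp: holomorphic_map_on_def differentiable_def)
  have dK: "K differentiable at y" if "y \<in> U'" for y
    using that holK by (auto simp: holomorphic_map_on_def differentiable_def)
  have GE: "G ` E = E'"
    using F GF by (auto simp: bij_betw_def)
  have "E \<subseteq> U"
    using U(2) closure_subset by blast
  then have KE: "K ` E' = E"
    unfolding GE[symmetric] image_image using KG by (simp add: subset_eq)
  \<comment> \<open>Supplies a point at which to compare dimensions. For \<open>m = 0\<close> the
    egg would be empty, since \<open>norm w ^ 0 = 1\<close>.\<close>
  have "0 \<in> E"
    using \<open>m \<ge> 1\<close> by (simp add: E_def egg_def zero_prod_def power_0_left)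
  then have "0 \<in> U"
    using \<open>E \<subseteq> U\<close> by blast
  have "CARD('k) \<le> CARD('l)"
    using card_le_of_left_inverse[OF dG dK U(1)] \<open>0 \<in> U\<close> GU KG by blast
  moreover have "CARD('l) \<le> CARD('k)"
    using card_le_of_left_inverse[OF dK dG U'(1), of "G 0"] \<open>0 \<in> U\<close> GU GK KG by auto
  moreover have "m \<le> m'"
    using egg_exponent_le[OF assms(3,4) U[unfolded E_def] G(2) dK[OF GU] KG GE[unfolded E_def E'_def]] .
  moreover have "m' \<le> m"
    using egg_exponent_le[OF assms(4,3) U'[unfolded E'_def] holK dG[OF KU] GK KE[unfolded E_def E'_def]] .
  ultimately show ?thesis
    using assms by linarith
qed

end
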